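(* Let $G$ be a group acting by automorphisms of a group $V$, let $\Gamma$ be a subgroup of $G$ leaving a subgroup $V_0$ of $V$ invariant, and suppose that $(V\rtimes G,V_0\rtimes\Gamma)$ is a Hecke pair. Suppose that $(\overline{V\rtimes G},\overline{V_0\rtimes\Gamma})$ and $\rho:V\rtimes G\to\overline{V\rtimes G}$ form a completion of $(V\rtimes G,V_0\rtimes\Gamma)$, and for each subset $X\subset V\rtimes G$ let $X^\sharp$ denote the closure of $\rho(X)$ in $\overline{V\rtimes G}$. Then there is a continuous action of $G^\sharp$ by homeomorphic automorphisms of $V^\sharp$ such that $(V^\sharp\rtimes G^\sharp,V_0^\sharp\rtimes\Gamma^\sharp)$ and the homomorphism $\iota:(v,g)\mapsto(\rho(v),\rho(g))$ from $V\rtimes G$ into $V^\sharp\rtimes G^\sharp$ form a completion of $(V\rtimes G,V_0\rtimes\Gamma)$.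
   Context: A pair $(N,N_0)$ of a group and a subgroup is a Hecke pair if $[N_0:N_0\cap xN_0x^{-1}]<\infty$ for all $x\in N$. A pair $(\bar N,\bar N_0)$ and a group homomorphism $\rho:N\to\bar N$ form a completion of a Hecke pair $(N,N_0)$ if $\bar N$ is a locally compact group, $\bar N_0$ is a compact open subgroup of $\bar N$, $\rho(N)$ is dense in $\bar N$, $\rho(N_0)$ is dense in $\bar N_0$, and $\rho^{-1}(\bar N_0)=N_0$. Semidirect products: $(v,g)(w,h)=(v\,g(w),gh)$; $V$ and $G$ are identified with their images in $V\rtimes G$. *)

theory Defs
  imports "HOL-Analysis.Analysis" "HOL-Algebra.Bij" "HOL-Algebra.Coset"
begin

section \<open>Semidirect products\<close>

definition acts_by_automorphisms ::
    "('g, 'm) monoid_scheme \<Rightarrow> ('v, 'n) monoid_scheme \<Rightarrow> ('g \<Rightarrow> 'v \<Rightarrow> 'v) \<Rightarrow> bool"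
  where "acts_by_automorphisms G V \<phi> \<longleftrightarrow> group G \<and> group V \<and> \<phi> \<in> hom G (AutoGroup V)"

definition semidirect_product ::
    "('v, 'n) monoid_scheme \<Rightarrow> ('g, 'm) monoid_scheme \<Rightarrow> ('g \<Rightarrow> 'v \<Rightarrow> 'v) \<Rightarrow> ('v \<times> 'g) monoid"
  where "semidirect_product V G \<phi> =
    \<lparr>carrier = carrier V \<times> carrier G,
     mult = (\<lambda>(v, g) (w, h). (v \<otimes>\<^bsub>V\<^esub> \<phi> g w, g \<otimes>\<^bsub>G\<^esub> h)),
     one = (\<one>\<^bsub>V\<^esub>, \<one>\<^bsub>G\<^esub>)\<rparr>"

lemma acts_by_automorphismsD:
  assumes "acts_by_automorphisms G V \<phi>" "g \<in> carrier G"
  shows "\<phi> g \<in> hom V V" "bij_betw (\<phi> g) (carrier V) (carrier V)"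
    and "v \<in> carrier V \<Longrightarrow> \<phi> \<one>\<^bsub>G\<^esub> v = v"
    and "h \<in> carrier G \<Longrightarrow> v \<in> carrier V \<Longrightarrow> \<phi> (g \<otimes>\<^bsub>G\<^esub> h) v = \<phi> g (\<phi> h v)"
proof -
  have G: "group G" and V: "group V" and \<phi>: "\<phi> \<in> hom G (AutoGroup V)"
    using assms(1) by (auto simp: acts_by_automorphisms_def)
  have auto: "\<phi> x \<in> auto V" if "x \<in> carrier G" for x
    using hom_in_carrier[OF \<phi> that] by (simp add: AutoGroup_def)
  show "\<phi> g \<in> hom V V" "bij_betw (\<phi> g) (carrier V) (carrier V)"
    using auto[OF assms(2)] by (auto simp: auto_def Bij_def)
  show "\<phi> \<one>\<^bsub>G\<^esub> v = v" if "v \<in> carrier V"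
    using hom_one[OF \<phi> G group.AutoGroup[OF V]] that by (simp add: AutoGroup_def BijGroup_def)
  show "\<phi> (g \<otimes>\<^bsub>G\<^esub> h) v = \<phi> g (\<phi> h v)" if "h \<in> carrier G" "v \<in> carrier V"
    using hom_mult[OF \<phi> assms(2) that(1)] auto[OF assms(2)] auto[OF that(1)] that(2)
    by (simp add: AutoGroup_def BijGroup_def auto_def compose_def)
qed

lemma group_semidirect_product:
  assumes "acts_by_automorphisms G V \<phi>"
  shows "group (semidirect_product V G \<phi>)"
proof -
  interpret G: group G using assms by (simp add: acts_by_automorphisms_def)
  interpret V: group V using assms by (simp add: acts_by_automorphisms_def)
  note act = acts_by_automorphismsD[OF assms]
  have clo: "\<phi> g v \<in> carrier V" if "g \<in> carrier G" "v \<in> carrier V" for g v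
    using hom_in_carrier[OF act(1)] that by blast
  have mul: "\<phi> g (v \<otimes>\<^bsub>V\<^esub> w) = \<phi> g v \<otimes>\<^bsub>V\<^esub> \<phi> g w"
    if "g \<in> carrier G" "v \<in> carrier V" "w \<in> carrier V" for g v w
    using hom_mult[OF act(1)] that by blast
  show ?thesis
  proof (rule groupI)
    fix x assume "x \<in> carrier (semidirect_product V G \<phi>)"
    then obtain v g where x: "x = (v, g)" "v \<in> carrier V" "g \<in> carrier G"
      by (auto simp: semidirect_product_def)
    let ?h = "inv\<^bsub>G\<^esub> g"
    have "(inv\<^bsub>V\<^esub> (\<phi> ?h v), ?h) \<otimes>\<^bsub>semidirect_product V G \<phi>\<^esub> x = \<one>\<^bsub>semidirect_product V G \<phi>\<^esub>"
      using x by (simp add: semidirect_product_def clo V.l_inv G.l_inv)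
    then show "\<exists>y\<in>carrier (semidirect_product V G \<phi>).
        y \<otimes>\<^bsub>semidirect_product V G \<phi>\<^esub> x = \<one>\<^bsub>semidirect_product V G \<phi>\<^esub>"
      using x clo by (intro bexI[of _ "(inv\<^bsub>V\<^esub> (\<phi> ?h v), ?h)"]) (auto simp: semidirect_product_def)
  qed (auto simp: semidirect_product_def clo mul act V.m_assoc G.m_assoc)
qed


section \<open>Hecke pairs\<close>

text \<open>The index is that of the subgroup \<open>N\<^sub>0 \<inter> x N\<^sub>0 x\<^sup>-\<^sup>1\<close> in \<open>N\<^sub>0\<close>, hence the cosets are
  taken by elements of \<open>N\<^sub>0\<close> only.\<close>

definition hecke_pair :: "('a, 'm) monoid_scheme \<Rightarrow> 'a set \<Rightarrow> bool"
  where "hecke_pair N N\<^sub>0 \<longleftrightarrow> group N \<and> subgroup N\<^sub>0 N \<and>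
    (\<forall>x\<in>carrier N.
      finite (rcosets\<^bsub>N\<lparr>carrier := N\<^sub>0\<rparr>\<^esub> (N\<^sub>0 \<inter> (x <#\<^bsub>N\<^esub> N\<^sub>0 #>\<^bsub>N\<^esub> inv\<^bsub>N\<^esub> x))))"


section \<open>Topological groups and completions\<close>

locale topological_group = group G for G (structure) +
  fixes T :: "'a topology"
  assumes topspace_eq: "topspace T = carrier G"
    and continuous_mult: "continuous_map (prod_topology T T) T (\<lambda>(x, y). x \<otimes> y)"
    and continuous_inv: "continuous_map T T (\<lambda>x. inv x)"

text \<open>Locally compact groups are Hausdorff by convention.\<close>

locale locally_compact_group = topological_group +
  assumes Hausdorff: "Hausdorff_space T"
    and locally_compact: "locally_compact_space T"

definition hecke_completion ::
    "('a, 'm) monoid_scheme \<Rightarrow> 'a set \<Rightarrow>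
     ('b, 'n) monoid_scheme \<Rightarrow> 'b topology \<Rightarrow> 'b set \<Rightarrow> ('a \<Rightarrow> 'b) \<Rightarrow> bool"
  where "hecke_completion N N\<^sub>0 M T M\<^sub>0 \<rho> \<longleftrightarrow>
    hecke_pair N N\<^sub>0 \<and>
    locally_compact_group M T \<and>
    subgroup M\<^sub>0 M \<and> compactin T M\<^sub>0 \<and> openin T M\<^sub>0 \<and>
    \<rho> \<in> hom N M \<and>
    T closure_of (\<rho> ` carrier N) = carrier M \<and>
    \<rho> ` N\<^sub>0 \<subseteq> M\<^sub>0 \<and> subtopology T M\<^sub>0 closure_of (\<rho> ` N\<^sub>0) = M\<^sub>0 \<and>
    {x \<in> carrier N. \<rho> x \<in> M\<^sub>0} = N\<^sub>0"

definition continuous_action_by_automorphisms ::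
    "('g, 'm) monoid_scheme \<Rightarrow> 'g topology \<Rightarrow> ('v, 'n) monoid_scheme \<Rightarrow> 'v topology \<Rightarrow>
     ('g \<Rightarrow> 'v \<Rightarrow> 'v) \<Rightarrow> bool"
  where "continuous_action_by_automorphisms G S V T \<psi> \<longleftrightarrow>
    topological_group G S \<and> topological_group V T \<and>
    acts_by_automorphisms G V \<psi> \<and>
    (\<forall>g\<in>carrier G. homeomorphic_map T T (\<psi> g)) \<and>
    continuous_map (prod_topology S T) T (\<lambda>(g, v). \<psi> g v)"

end

theory Submission
  imports Defs
begin

text \<open>
  Write \<open>N = V \<rtimes> G\<close> and let \<open>M\<close>, with compact open subgroup \<open>M\<^sub>0\<close>, be the given completion.
  Inside \<open>N\<close> the action of \<open>G\<close> on \<open>V\<close> is conjugation, so the only candidate for the action of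
  \<open>G\<^sup>\<sharp>\<close> on \<open>V\<^sup>\<sharp>\<close> is conjugation in \<open>M\<close>.  It is well defined because \<open>\<rho>(G)\<close> normalises \<open>\<rho>(V)\<close> and
  this relation passes to closures by continuity of \<open>(x, y) \<mapsto> x y x\<^sup>-\<^sup>1\<close>
  (\<open>closure_of_closed_under\<close>), and it is a continuous action because conjugation is jointly
  continuous (\<open>continuous_action_conjugation_on\<close>).  Closed subgroups of \<open>M\<close> are locally compact,
  hence so is the semidirect product \<open>V\<^sup>\<sharp> \<rtimes> G\<^sup>\<sharp>\<close> in the product topology
  (\<open>locally_compact_group_semidirect_product\<close>).

  The remaining point is that \<open>V\<^sub>0\<^sup>\<sharp> \<times> \<Gamma>\<^sup>\<sharp>\<close> is a compact open subgroup pulling back to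
  \<open>V\<^sub>0 \<times> \<Gamma>\<close>.  All of this follows from the identities \<open>V\<^sub>0\<^sup>\<sharp> = M\<^sub>0 \<inter> V\<^sup>\<sharp>\<close> and \<open>\<Gamma>\<^sup>\<sharp> = M\<^sub>0 \<inter> G\<^sup>\<sharp>\<close>,
  both instances of \<open>completion_closure_trace\<close>: since \<open>M\<^sub>0\<close> is open and closed and
  \<open>\<rho>\<^sup>-\<^sup>1(M\<^sub>0) = V\<^sub>0 \<rtimes> \<Gamma>\<close>, taking closures of images commutes with intersecting with these
  subgroups.  For instance \<open>\<Gamma>\<^sup>\<sharp>\<close> preserves \<open>V\<^sub>0\<^sup>\<sharp>\<close> because conjugation by elements of \<open>M\<^sub>0 \<inter> G\<^sup>\<sharp>\<close>
  preserves both \<open>M\<^sub>0\<close> and \<open>V\<^sup>\<sharp>\<close>.  Density of \<open>\<iota>(V \<rtimes> G)\<close> holds factor by factor, since the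
  closure of a product is the product of the closures.
\<close>


section \<open>Topological groups and their subgroups\<close>

context topological_group
begin

lemma continuous_map_mult':
  assumes "continuous_map X T f" "continuous_map X T g"
  shows "continuous_map X T (\<lambda>x. f x \<otimes> g x)"
proof -
  have "continuous_map X (prod_topology T T) (\<lambda>x. (f x, g x))"
    using assms by (simp add: continuous_map_pairedI)
  from continuous_map_compose[OF this continuous_mult] show ?thesis
    by (simp add: o_def)
qed

lemma continuous_map_inv':
  assumes "continuous_map X T f"
  shows "continuous_map X T (\<lambda>x. inv (f x))"
  using continuous_map_compose[OF assms continuous_inv] by (simp add: o_def)

lemma continuous_map_conjugation:
  "continuous_map (prod_topology T T) T (\<lambda>(x, y). x \<otimes> y \<otimes> inv x)"
  unfolding case_prod_unfold
  by (intro continuous_map_mult' continuous_map_inv' continuous_map_fst continuous_map_snd)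

lemma closure_of_subset_carrier: "T closure_of A \<subseteq> carrier G"
  using closure_of_subset_topspace[of T A] by (simp add: topspace_eq)

text \<open>A relation of the form \<open>f(A \<times> B) \<subseteq> C\<close> with \<open>f\<close> continuous survives closing all three sets,
  because the closure of \<open>A \<times> B\<close> is the product of the closures.  With \<open>f\<close> the multiplication this
  makes closures of subgroups multiplicatively closed; with \<open>f\<close> the conjugation it transfers
  normalisation to closures.\<close>

lemma closure_of_closed_under:
  assumes f: "continuous_map (prod_topology T T) T f"
    and A: "\<And>x y. x \<in> A \<Longrightarrow> y \<in> B \<Longrightarrow> f (x, y) \<in> C"
    and xy: "x \<in> T closure_of A" "y \<in> T closure_of B"
  shows "f (x, y) \<in> T closure_of C"
proof -
  have "f ` (prod_topology T T closure_of (A \<times> B)) \<subseteq> T closure_of (f ` (A \<times> B))"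
    by (rule continuous_map_image_closure_subset[OF f])
  also have "\<dots> \<subseteq> T closure_of C"
    by (rule closure_of_mono) (use A in auto)
  finally show ?thesis
    using xy by (auto simp: closure_of_Times)
qed

lemma subgroup_closure_of:
  assumes "subgroup H G"
  shows "subgroup (T closure_of H) G"
proof
  interpret H: subgroup H G by fact
  have HT: "H \<subseteq> T closure_of H"
    by (rule closure_of_subset) (simp add: topspace_eq H.subset)
  show "T closure_of H \<subseteq> carrier G" by (rule closure_of_subset_carrier)
  show "\<one> \<in> T closure_of H" using HT by auto
  show "x \<otimes> y \<in> T closure_of H" if "x \<in> T closure_of H" "y \<in> T closure_of H" for x y
    using closure_of_closed_under[OF continuous_mult, of H H H] that by auto
  show "inv x \<in> T closure_of H" if "x \<in> T closure_of H" for x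
  proof -
    have "(\<lambda>x. inv x) ` (T closure_of H) \<subseteq> T closure_of ((\<lambda>x. inv x) ` H)"
      by (rule continuous_map_image_closure_subset[OF continuous_inv])
    also have "\<dots> \<subseteq> T closure_of H"
      by (rule closure_of_mono) auto
    finally show ?thesis using that by auto
  qed
qed

lemma topological_group_subgroup:
  assumes "subgroup H G"
  shows "topological_group (G\<lparr>carrier := H\<rparr>) (subtopology T H)"
proof -
  interpret H: subgroup H G by fact
  interpret GH: group "G\<lparr>carrier := H\<rparr>"
    by (rule H.subgroup_is_group[OF is_group])
  show ?thesis
  proof
    show "topspace (subtopology T H) = carrier (G\<lparr>carrier := H\<rparr>)"
      using H.subset by (auto simp: topspace_eq)
    have "continuous_map (prod_topology (subtopology T H) (subtopology T H)) T (\<lambda>(x, y). x \<otimes> y)"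
      unfolding subtopology_Times[symmetric]
      by (intro continuous_map_from_subtopology continuous_mult)
    then show "continuous_map (prod_topology (subtopology T H) (subtopology T H)) (subtopology T H)
        (\<lambda>(x, y). x \<otimes>\<^bsub>G\<lparr>carrier := H\<rparr>\<^esub> y)"
      by (auto simp: continuous_map_in_subtopology)
    have "continuous_map (subtopology T H) (subtopology T H) (\<lambda>x. inv x)"
      using continuous_inv by (auto simp: continuous_map_in_subtopology continuous_map_from_subtopology)
    then show "continuous_map (subtopology T H) (subtopology T H)
        (\<lambda>x. inv\<^bsub>G\<lparr>carrier := H\<rparr>\<^esub> x)"
      by (rule continuous_map_eq) (simp add: m_inv_consistent[OF assms])
  qed
qed

end

lemma (in locally_compact_group) locally_compact_group_closed_subgroup:
  assumes "subgroup H G" and "closedin T H"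
  shows "locally_compact_group (G\<lparr>carrier := H\<rparr>) (subtopology T H)"
proof -
  interpret H: topological_group "G\<lparr>carrier := H\<rparr>" "subtopology T H"
    by (rule topological_group_subgroup) fact
  show ?thesis
    by unfold_locales
      (simp_all add: Hausdorff Hausdorff_space_subtopology
        locally_compact_space_closed_subset locally_compact assms(2))
qed


section \<open>Continuous actions and semidirect products\<close>

text \<open>The explicit inverse reduces continuity of inversion, and closure of a product of subgroups
  under inverses, to properties of the two factors and of the action.\<close>

lemma inv_semidirect_product:
  assumes act: "acts_by_automorphisms G V \<phi>" and v: "v \<in> carrier V" and g: "g \<in> carrier G"
  shows "inv\<^bsub>semidirect_product V G \<phi>\<^esub> (v, g) = (\<phi> (inv\<^bsub>G\<^esub> g) (inv\<^bsub>V\<^esub> v), inv\<^bsub>G\<^esub> g)"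
proof -
  interpret G: group G using act by (simp add: acts_by_automorphisms_def)
  interpret V: group V using act by (simp add: acts_by_automorphisms_def)
  interpret S: group "semidirect_product V G \<phi>" by (rule group_semidirect_product[OF act])
  note actD = acts_by_automorphismsD[OF act]
  have clo: "\<phi> h w \<in> carrier V" if "h \<in> carrier G" "w \<in> carrier V" for h w
    using hom_in_carrier[OF actD(1)] that by blast
  have mul: "\<phi> (inv\<^bsub>G\<^esub> g) (inv\<^bsub>V\<^esub> v) \<otimes>\<^bsub>V\<^esub> \<phi> (inv\<^bsub>G\<^esub> g) v = \<phi> (inv\<^bsub>G\<^esub> g) (inv\<^bsub>V\<^esub> v \<otimes>\<^bsub>V\<^esub> v)"
    using hom_mult[OF actD(1)[of "inv\<^bsub>G\<^esub> g"], of "inv\<^bsub>V\<^esub> v" v] v g by simp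
  have "\<phi> (inv\<^bsub>G\<^esub> g) \<one>\<^bsub>V\<^esub> = \<one>\<^bsub>V\<^esub>"
    using hom_one[OF actD(1) V.is_group V.is_group] g by simp
  with v g clo mul show ?thesis
    by (intro S.inv_equality) (auto simp: semidirect_product_def V.l_inv G.l_inv)
qed

lemma subgroup_semidirect_product:
  assumes act: "acts_by_automorphisms G V \<psi>"
    and W: "subgroup W V" and H: "subgroup H G"
    and inv: "\<And>h w. h \<in> H \<Longrightarrow> w \<in> W \<Longrightarrow> \<psi> h w \<in> W"
  shows "subgroup (W \<times> H) (semidirect_product V G \<psi>)"
proof -
  interpret W: subgroup W V by fact
  interpret H: subgroup H G by fact
  have inv_closed: "inv\<^bsub>semidirect_product V G \<psi>\<^esub> (w, h) \<in> W \<times> H" if "w \<in> W" "h \<in> H" for w h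
    using that inv by (simp add: inv_semidirect_product[OF act])
  show ?thesis
    by unfold_locales (use inv_closed inv in \<open>auto simp: semidirect_product_def\<close>)
qed

text \<open>The action is recovered as conjugation inside the semidirect product; this is what dictates
  the action on the completed side.\<close>

lemma conjugate_semidirect_product:
  assumes act: "acts_by_automorphisms G V \<phi>" and v: "v \<in> carrier V" and g: "g \<in> carrier G"
  shows "(\<one>\<^bsub>V\<^esub>, g) \<otimes>\<^bsub>semidirect_product V G \<phi>\<^esub> (v, \<one>\<^bsub>G\<^esub>)
      \<otimes>\<^bsub>semidirect_product V G \<phi>\<^esub> inv\<^bsub>semidirect_product V G \<phi>\<^esub> (\<one>\<^bsub>V\<^esub>, g) = (\<phi> g v, \<one>\<^bsub>G\<^esub>)"
proof -
  interpret G: group G using act by (simp add: acts_by_automorphisms_def)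
  interpret V: group V using act by (simp add: acts_by_automorphisms_def)
  note actD = acts_by_automorphismsD[OF act]
  have "\<phi> h \<one>\<^bsub>V\<^esub> = \<one>\<^bsub>V\<^esub>" if "h \<in> carrier G" for h
    using hom_one[OF actD(1) V.is_group V.is_group] that by simp
  then show ?thesis
    using v g hom_in_carrier[OF actD(1)[OF g] v]
    by (simp add: inv_semidirect_product[OF act]) (simp add: semidirect_product_def)
qed

lemma topological_group_semidirect_product:
  assumes "continuous_action_by_automorphisms G S V T \<psi>"
  shows "topological_group (semidirect_product V G \<psi>) (prod_topology T S)"
proof -
  interpret G: topological_group G S using assms by (simp add: continuous_action_by_automorphisms_def)
  interpret V: topological_group V T using assms by (simp add: continuous_action_by_automorphisms_def)
  have act: "acts_by_automorphisms G V \<psi>"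
    and cont: "continuous_map (prod_topology S T) T (\<lambda>(g, v). \<psi> g v)"
    using assms by (auto simp: continuous_action_by_automorphisms_def)
  interpret P: group "semidirect_product V G \<psi>" by (rule group_semidirect_product[OF act])
  have cont': "continuous_map X T (\<lambda>x. \<psi> (f x) (h x))"
    if "continuous_map X S f" "continuous_map X T h" for X and f :: "'e \<Rightarrow> 'a" and h
    using continuous_map_compose[OF _ cont, of X "\<lambda>x. (f x, h x)"] that
    by (simp add: continuous_map_pairedI o_def)
  show ?thesis
  proof
    show "topspace (prod_topology T S) = carrier (semidirect_product V G \<psi>)"
      by (simp add: semidirect_product_def V.topspace_eq G.topspace_eq)
    let ?P = "prod_topology (prod_topology T S) (prod_topology T S)"
    have c: "continuous_map ?P T (\<lambda>x. fst (fst x))" "continuous_map ?P S (\<lambda>x. snd (fst x))"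
        "continuous_map ?P T (\<lambda>x. fst (snd x))" "continuous_map ?P S (\<lambda>x. snd (snd x))"
      by (rule continuous_map_compose[OF continuous_map_fst continuous_map_fst, unfolded o_def]
          continuous_map_compose[OF continuous_map_fst continuous_map_snd, unfolded o_def]
          continuous_map_compose[OF continuous_map_snd continuous_map_fst, unfolded o_def]
          continuous_map_compose[OF continuous_map_snd continuous_map_snd, unfolded o_def])+
    have "continuous_map ?P (prod_topology T S)
        (\<lambda>x. (fst (fst x) \<otimes>\<^bsub>V\<^esub> \<psi> (snd (fst x)) (fst (snd x)), snd (fst x) \<otimes>\<^bsub>G\<^esub> snd (snd x)))"
      by (intro continuous_map_pairedI V.continuous_map_mult' G.continuous_map_mult' cont' c)
    then show "continuous_map ?P (prod_topology T S) (\<lambda>(x, y). x \<otimes>\<^bsub>semidirect_product V G \<psi>\<^esub> y)"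
      by (simp add: semidirect_product_def case_prod_unfold)
    have "continuous_map (prod_topology T S) (prod_topology T S)
        (\<lambda>x. (\<psi> (inv\<^bsub>G\<^esub> snd x) (inv\<^bsub>V\<^esub> fst x), inv\<^bsub>G\<^esub> snd x))"
      by (intro continuous_map_pairedI V.continuous_map_inv' G.continuous_map_inv' cont'
          continuous_map_fst continuous_map_snd)
    then show "continuous_map (prod_topology T S) (prod_topology T S)
        (\<lambda>x. inv\<^bsub>semidirect_product V G \<psi>\<^esub> x)"
      by (rule continuous_map_eq)
        (auto simp: inv_semidirect_product[OF act] V.topspace_eq G.topspace_eq)
  qed
qed

lemma locally_compact_group_semidirect_product:
  assumes act: "continuous_action_by_automorphisms G S V T \<psi>"
    and G: "locally_compact_group G S" and V: "locally_compact_group V T"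
  shows "locally_compact_group (semidirect_product V G \<psi>) (prod_topology T S)"
proof -
  interpret G: locally_compact_group G S by fact
  interpret V: locally_compact_group V T by fact
  interpret P: topological_group "semidirect_product V G \<psi>" "prod_topology T S"
    by (rule topological_group_semidirect_product[OF act])
  show ?thesis
    by unfold_locales
      (simp_all add: Hausdorff_space_prod_topology locally_compact_space_prod_topology
        G.Hausdorff V.Hausdorff G.locally_compact V.locally_compact)
qed

text \<open>The function is made extensional (undefined outside \<open>K\<close>) because the elements of the
  automorphism group \<open>AutoGroup\<close> are extensional bijections.\<close>

definition conjugation_on :: "('a, 'm) monoid_scheme \<Rightarrow> 'a set \<Rightarrow> 'a \<Rightarrow> 'a \<Rightarrow> 'a"
  where "conjugation_on M K x = (\<lambda>y\<in>K. x \<otimes>\<^bsub>M\<^esub> y \<otimes>\<^bsub>M\<^esub> inv\<^bsub>M\<^esub> x)"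

lemma (in group) acts_by_automorphisms_conjugation_on:
  assumes H: "subgroup H G" and K: "subgroup K G"
    and norm: "\<And>x y. x \<in> H \<Longrightarrow> y \<in> K \<Longrightarrow> x \<otimes> y \<otimes> inv x \<in> K"
  shows "acts_by_automorphisms (G\<lparr>carrier := H\<rparr>) (G\<lparr>carrier := K\<rparr>) (conjugation_on G K)"
proof -
  interpret H: subgroup H G by fact
  interpret K: subgroup K G by fact
  have comp: "x \<otimes> (y \<otimes> z \<otimes> inv y) \<otimes> inv x = (x \<otimes> y) \<otimes> z \<otimes> inv (x \<otimes> y)"
    if "x \<in> carrier G" "y \<in> carrier G" "z \<in> carrier G" for x y z
    using that by (simp add: m_assoc inv_mult_group)
  have cancel: "inv x \<otimes> (x \<otimes> z \<otimes> inv x) \<otimes> x = z" "x \<otimes> (inv x \<otimes> z \<otimes> x) \<otimes> inv x = z"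
    if "x \<in> carrier G" "z \<in> carrier G" for x z
    using comp[of "inv x" x z] comp[of x "inv x" z] that by simp_all
  have auto: "conjugation_on G K x \<in> auto (G\<lparr>carrier := K\<rparr>)" if x: "x \<in> H" for x
  proof -
    have "x \<otimes> (y \<otimes> z) \<otimes> inv x = (x \<otimes> y \<otimes> inv x) \<otimes> (x \<otimes> z \<otimes> inv x)" if "y \<in> K" "z \<in> K" for y z
    proof -
      have c: "x \<in> carrier G" "y \<in> carrier G" "z \<in> carrier G" using that x by auto
      have "inv x \<otimes> (x \<otimes> (z \<otimes> inv x)) = z \<otimes> inv x"
        using c by (simp flip: m_assoc)
      then show ?thesis using c by (simp add: m_assoc)
    qed
    then have "conjugation_on G K x \<in> hom (G\<lparr>carrier := K\<rparr>) (G\<lparr>carrier := K\<rparr>)"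
      using norm x by (auto simp: hom_def conjugation_on_def)
    moreover have "bij_betw (conjugation_on G K x) K K"
      using norm[of x] norm[of "inv x"] x
      by (intro bij_betw_byWitness[of _ "conjugation_on G K (inv x)"])
        (auto simp: conjugation_on_def cancel)
    ultimately show ?thesis
      by (auto simp: auto_def Bij_def conjugation_on_def)
  qed
  have "conjugation_on G K (x \<otimes> y)
      = compose K (conjugation_on G K x) (conjugation_on G K y)" if "x \<in> H" "y \<in> H" for x y
    using that norm by (auto simp: compose_def conjugation_on_def comp fun_eq_iff)
  then have "conjugation_on G K \<in> hom (G\<lparr>carrier := H\<rparr>) (AutoGroup (G\<lparr>carrier := K\<rparr>))"
    using auto by (auto simp: hom_def AutoGroup_def BijGroup_def auto_def)
  then show ?thesis
    using H.subgroup_is_group K.subgroup_is_group is_group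
    by (simp add: acts_by_automorphisms_def)
qed

text \<open>Everything is inherited from the joint continuity of conjugation on the ambient group; each
  single automorphism is a homeomorphism because conjugation by the inverse element undoes it.\<close>

lemma (in topological_group) continuous_action_conjugation_on:
  assumes H: "subgroup H G" and K: "subgroup K G"
    and norm: "\<And>x y. x \<in> H \<Longrightarrow> y \<in> K \<Longrightarrow> x \<otimes> y \<otimes> inv x \<in> K"
  shows "continuous_action_by_automorphisms
    (G\<lparr>carrier := H\<rparr>) (subtopology T H) (G\<lparr>carrier := K\<rparr>) (subtopology T K) (conjugation_on G K)"
proof -
  interpret H: subgroup H G by fact
  interpret K: subgroup K G by fact
  have act: "acts_by_automorphisms (G\<lparr>carrier := H\<rparr>) (G\<lparr>carrier := K\<rparr>) (conjugation_on G K)"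
    by (rule acts_by_automorphisms_conjugation_on) (use assms in auto)
  note actD = acts_by_automorphismsD[OF act, simplified]
  have "continuous_map (prod_topology (subtopology T H) (subtopology T K)) T (\<lambda>(x, y). x \<otimes> y \<otimes> inv x)"
    unfolding subtopology_Times[symmetric]
    by (intro continuous_map_from_subtopology continuous_map_conjugation)
  then have "continuous_map (prod_topology (subtopology T H) (subtopology T K)) (subtopology T K)
      (\<lambda>(x, y). x \<otimes> y \<otimes> inv x)"
    using norm by (auto simp: continuous_map_in_subtopology)
  then have cont: "continuous_map (prod_topology (subtopology T H) (subtopology T K)) (subtopology T K)
      (\<lambda>(x, y). conjugation_on G K x y)"
    by (rule continuous_map_eq) (auto simp: conjugation_on_def)
  have cont1: "continuous_map (subtopology T K) (subtopology T K) (conjugation_on G K x)"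
    if "x \<in> H" for x
  proof -
    have "continuous_map (subtopology T K) (prod_topology (subtopology T H) (subtopology T K))
        (\<lambda>y. (x, y))"
      using that by (intro continuous_map_pairedI) (auto simp: topspace_eq)
    from continuous_map_compose[OF this cont] show ?thesis by (simp add: o_def)
  qed
  have "homeomorphic_map (subtopology T K) (subtopology T K) (conjugation_on G K x)"
    if x: "x \<in> H" for x
  proof -
    have "homeomorphic_maps (subtopology T K) (subtopology T K)
        (conjugation_on G K x) (conjugation_on G K (inv x))"
      using x cont1 actD(4)[of x "inv x"] actD(4)[of "inv x" x] actD(3)
      by (auto simp: homeomorphic_maps_def)
    then show ?thesis using homeomorphic_map_maps by blast
  qed
  with act cont topological_group_subgroup[OF H] topological_group_subgroup[OF K] show ?thesis
    by (simp add: continuous_action_by_automorphisms_def)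
qed


section \<open>Closures of images in a completion\<close>

text \<open>The compact open subgroup \<open>M\<^sub>0\<close> is clopen.  Openness gives that \<open>M\<^sub>0\<close> meets the closure of
  \<open>\<rho>(X)\<close> only in limits of points of \<open>\<rho>(X) \<inter> M\<^sub>0\<close>, which is \<open>\<rho>(X \<inter> N\<^sub>0)\<close> because \<open>N\<^sub>0\<close> is the full
  preimage of \<open>M\<^sub>0\<close>; closedness gives the converse inclusion.\<close>

lemma completion_closure_trace:
  assumes "hecke_completion N N\<^sub>0 M T M\<^sub>0 \<rho>" and X: "X \<subseteq> carrier N"
  shows "T closure_of (\<rho> ` (X \<inter> N\<^sub>0)) = M\<^sub>0 \<inter> T closure_of (\<rho> ` X)"
proof
  have op: "openin T M\<^sub>0" and cpt: "compactin T M\<^sub>0" and lc: "locally_compact_group M T"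
    and pre: "{x \<in> carrier N. \<rho> x \<in> M\<^sub>0} = N\<^sub>0"
    using assms by (auto simp: hecke_completion_def)
  have "closedin T M\<^sub>0"
    by (rule compactin_imp_closedin[OF _ cpt]) (rule locally_compact_group.Hausdorff[OF lc])
  then have "T closure_of (\<rho> ` (X \<inter> N\<^sub>0)) \<subseteq> M\<^sub>0"
    by (rule closure_of_minimal[rotated]) (use pre in auto)
  moreover have "T closure_of (\<rho> ` (X \<inter> N\<^sub>0)) \<subseteq> T closure_of (\<rho> ` X)"
    by (rule closure_of_mono) auto
  ultimately show "T closure_of (\<rho> ` (X \<inter> N\<^sub>0)) \<subseteq> M\<^sub>0 \<inter> T closure_of (\<rho> ` X)" by simp
  have "M\<^sub>0 \<inter> T closure_of (\<rho> ` X) \<subseteq> T closure_of (M\<^sub>0 \<inter> \<rho> ` X)"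
    using op by (rule openin_Int_closure_of_subset)
  also have "M\<^sub>0 \<inter> \<rho> ` X = \<rho> ` (X \<inter> N\<^sub>0)"
    using pre X by auto
  finally show "M\<^sub>0 \<inter> T closure_of (\<rho> ` X) \<subseteq> T closure_of (\<rho> ` (X \<inter> N\<^sub>0))" .
qed

lemma closure_of_in_closure_of:
  assumes "A \<subseteq> topspace X"
  shows "subtopology X (X closure_of A) closure_of A = X closure_of A"
  using closure_of_subset[OF assms] by (simp add: closure_of_subtopology Int_absorb1)


section \<open>The completion of a semidirect product\<close>

theorem proposition2p8:
  fixes V :: "('v, 'm) monoid_scheme" and G :: "('g, 'n) monoid_scheme"
    and \<phi> :: "'g \<Rightarrow> 'v \<Rightarrow> 'v"
    and V\<^sub>0 :: "'v set" and \<Gamma> :: "'g set"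
    and M :: "('b, 'k) monoid_scheme" and T :: "'b topology" and M\<^sub>0 :: "'b set"
    and \<rho> :: "'v \<times> 'g \<Rightarrow> 'b"
  assumes "acts_by_automorphisms G V \<phi>"
    and "subgroup V\<^sub>0 V"
    and "subgroup \<Gamma> G"
    and "\<And>g. g \<in> \<Gamma> \<Longrightarrow> \<phi> g ` V\<^sub>0 = V\<^sub>0"
    and "hecke_pair (semidirect_product V G \<phi>) (V\<^sub>0 \<times> \<Gamma>)"
    and "hecke_completion (semidirect_product V G \<phi>) (V\<^sub>0 \<times> \<Gamma>) M T M\<^sub>0 \<rho>"
  shows "let sharp = (\<lambda>X. T closure_of (\<rho> ` X));
             Vs = sharp (carrier V \<times> {\<one>\<^bsub>G\<^esub>});
             Gs = sharp ({\<one>\<^bsub>V\<^esub>} \<times> carrier G);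
             V\<^sub>0s = sharp (V\<^sub>0 \<times> {\<one>\<^bsub>G\<^esub>});
             \<Gamma>s = sharp ({\<one>\<^bsub>V\<^esub>} \<times> \<Gamma>)
         in \<exists>\<psi>. continuous_action_by_automorphisms
                   (M\<lparr>carrier := Gs\<rparr>) (subtopology T Gs) (M\<lparr>carrier := Vs\<rparr>) (subtopology T Vs) \<psi> \<and>
                hecke_completion (semidirect_product V G \<phi>) (V\<^sub>0 \<times> \<Gamma>)
                   (semidirect_product (M\<lparr>carrier := Vs\<rparr>) (M\<lparr>carrier := Gs\<rparr>) \<psi>)
                   (prod_topology (subtopology T Vs) (subtopology T Gs))
                   (V\<^sub>0s \<times> \<Gamma>s)
                   (\<lambda>(v, g). (\<rho> (v, \<one>\<^bsub>G\<^esub>), \<rho> (\<one>\<^bsub>V\<^esub>, g)))"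
proof -
  define N where "N = semidirect_product V G \<phi>"
  define sharp where "sharp = (\<lambda>X. T closure_of (\<rho> ` X))"
  define Vs where "Vs = sharp (carrier V \<times> {\<one>\<^bsub>G\<^esub>})"
  define Gs where "Gs = sharp ({\<one>\<^bsub>V\<^esub>} \<times> carrier G)"
  define V\<^sub>0s where "V\<^sub>0s = sharp (V\<^sub>0 \<times> {\<one>\<^bsub>G\<^esub>})"
  define \<Gamma>s where "\<Gamma>s = sharp ({\<one>\<^bsub>V\<^esub>} \<times> \<Gamma>)"
  define \<iota> where "\<iota> = (\<lambda>(v, g). (\<rho> (v, \<one>\<^bsub>G\<^esub>), \<rho> (\<one>\<^bsub>V\<^esub>, g)))"
  define \<psi> where "\<psi> = conjugation_on M Vs"
  define P where "P = semidirect_product (M\<lparr>carrier := Vs\<rparr>) (M\<lparr>carrier := Gs\<rparr>) \<psi>"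

  note act = assms(1)
  note actD = acts_by_automorphismsD[OF act]
  have compl: "hecke_completion N (V\<^sub>0 \<times> \<Gamma>) M T M\<^sub>0 \<rho>" using assms(6) by (simp add: N_def)
  interpret G: group G using act by (simp add: acts_by_automorphisms_def)
  interpret V: group V using act by (simp add: acts_by_automorphisms_def)
  interpret N: group N unfolding N_def by (rule group_semidirect_product[OF act])
  interpret M: locally_compact_group M T using compl by (simp add: hecke_completion_def)
  interpret V\<^sub>0: subgroup V\<^sub>0 V by fact
  interpret \<Gamma>: subgroup \<Gamma> G by fact
  have M\<^sub>0: "subgroup M\<^sub>0 M" "compactin T M\<^sub>0" "openin T M\<^sub>0"
    and \<rho>: "\<rho> \<in> hom N M" and pre: "\<And>x. x \<in> carrier N \<Longrightarrow> \<rho> x \<in> M\<^sub>0 \<longleftrightarrow> x \<in> V\<^sub>0 \<times> \<Gamma>"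
    using compl by (auto simp: hecke_completion_def)
  interpret M\<^sub>0: subgroup M\<^sub>0 M by fact
  interpret \<rho>: group_hom N M \<rho> by unfold_locales (rule \<rho>)
  have carN: "carrier N = carrier V \<times> carrier G" by (simp add: N_def semidirect_product_def)
  have \<phi>V: "\<phi> g v \<in> carrier V" if "g \<in> carrier G" "v \<in> carrier V" for g v
    using hom_in_carrier[OF actD(1)] that by blast
  have \<phi>1: "\<phi> g \<one>\<^bsub>V\<^esub> = \<one>\<^bsub>V\<^esub>" if "g \<in> carrier G" for g
    using hom_one[OF actD(1) V.is_group V.is_group] that by simp

  have subV: "subgroup (carrier V \<times> {\<one>\<^bsub>G\<^esub>}) N" unfolding N_def
    by (rule subgroup_semidirect_product[OF act V.subgroup_self G.triv_subgroup])
      (simp add: \<phi>V)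
  have subG: "subgroup ({\<one>\<^bsub>V\<^esub>} \<times> carrier G) N" unfolding N_def
    by (rule subgroup_semidirect_product[OF act V.triv_subgroup G.subgroup_self])
      (simp add: \<phi>1)
  have Vs: "subgroup Vs M" and Gs: "subgroup Gs M"
    unfolding Vs_def Gs_def sharp_def
    by (intro M.subgroup_closure_of \<rho>.subgroup_img_is_subgroup subV subG)+
  have closed: "closedin T (sharp X)" for X by (simp add: sharp_def)

  have \<rho>conj: "\<rho> (\<one>\<^bsub>V\<^esub>, g) \<otimes>\<^bsub>M\<^esub> \<rho> (v, \<one>\<^bsub>G\<^esub>) \<otimes>\<^bsub>M\<^esub> inv\<^bsub>M\<^esub> \<rho> (\<one>\<^bsub>V\<^esub>, g) = \<rho> (\<phi> g v, \<one>\<^bsub>G\<^esub>)"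
    if "v \<in> carrier V" "g \<in> carrier G" for v g
  proof -
    have "(\<one>\<^bsub>V\<^esub>, g) \<in> carrier N" "(v, \<one>\<^bsub>G\<^esub>) \<in> carrier N" using that by (auto simp: carN)
    then have "\<rho> ((\<one>\<^bsub>V\<^esub>, g) \<otimes>\<^bsub>N\<^esub> (v, \<one>\<^bsub>G\<^esub>) \<otimes>\<^bsub>N\<^esub> inv\<^bsub>N\<^esub> (\<one>\<^bsub>V\<^esub>, g))
        = \<rho> (\<one>\<^bsub>V\<^esub>, g) \<otimes>\<^bsub>M\<^esub> \<rho> (v, \<one>\<^bsub>G\<^esub>) \<otimes>\<^bsub>M\<^esub> inv\<^bsub>M\<^esub> \<rho> (\<one>\<^bsub>V\<^esub>, g)"
      by simp
    then show ?thesis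
      using conjugate_semidirect_product[OF act that] by (simp flip: N_def)
  qed
  \<comment> \<open>On the dense subgroups \<open>\<rho>(G)\<close> and \<open>\<rho>(V)\<close> this is the previous identity; continuity extends it
    to the closures.\<close>
  have norm: "x \<otimes>\<^bsub>M\<^esub> y \<otimes>\<^bsub>M\<^esub> inv\<^bsub>M\<^esub> x \<in> Vs" if "x \<in> Gs" "y \<in> Vs" for x y
  proof -
    have "(\<lambda>(x, y). x \<otimes>\<^bsub>M\<^esub> y \<otimes>\<^bsub>M\<^esub> inv\<^bsub>M\<^esub> x) (x, y) \<in> Vs"
      unfolding Vs_def sharp_def
    proof (rule M.closure_of_closed_under[OF M.continuous_map_conjugation])
      show "x \<in> T closure_of (\<rho> ` ({\<one>\<^bsub>V\<^esub>} \<times> carrier G))"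
        "y \<in> T closure_of (\<rho> ` (carrier V \<times> {\<one>\<^bsub>G\<^esub>}))"
        using that by (simp_all add: Vs_def Gs_def sharp_def)
    qed (auto simp: \<rho>conj \<phi>V)
    then show ?thesis by simp
  qed
  have cact: "continuous_action_by_automorphisms (M\<lparr>carrier := Gs\<rparr>) (subtopology T Gs)
      (M\<lparr>carrier := Vs\<rparr>) (subtopology T Vs) \<psi>"
    unfolding \<psi>_def by (rule M.continuous_action_conjugation_on[OF Gs Vs norm])
  then have act': "acts_by_automorphisms (M\<lparr>carrier := Gs\<rparr>) (M\<lparr>carrier := Vs\<rparr>) \<psi>"
    by (simp add: continuous_action_by_automorphisms_def)

  have lc: "locally_compact_group P (prod_topology (subtopology T Vs) (subtopology T Gs))"
    unfolding P_def
    by (intro locally_compact_group_semidirect_product cact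
        M.locally_compact_group_closed_subgroup Vs Gs)
      (simp_all add: Vs_def Gs_def closed)

  have V\<^sub>0s: "V\<^sub>0s = M\<^sub>0 \<inter> Vs"
  proof -
    have "V\<^sub>0 \<times> {\<one>\<^bsub>G\<^esub>} = (carrier V \<times> {\<one>\<^bsub>G\<^esub>}) \<inter> (V\<^sub>0 \<times> \<Gamma>)" using V\<^sub>0.subset by auto
    moreover have "carrier V \<times> {\<one>\<^bsub>G\<^esub>} \<subseteq> carrier N" by (auto simp: carN)
    ultimately show ?thesis
      unfolding V\<^sub>0s_def Vs_def sharp_def
      by (simp only: completion_closure_trace[OF compl])
  qed
  have \<Gamma>s: "\<Gamma>s = M\<^sub>0 \<inter> Gs"
  proof -
    have "{\<one>\<^bsub>V\<^esub>} \<times> \<Gamma> = ({\<one>\<^bsub>V\<^esub>} \<times> carrier G) \<inter> (V\<^sub>0 \<times> \<Gamma>)" using \<Gamma>.subset by auto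
    moreover have "{\<one>\<^bsub>V\<^esub>} \<times> carrier G \<subseteq> carrier N" by (auto simp: carN)
    ultimately show ?thesis
      unfolding \<Gamma>s_def Gs_def sharp_def
      by (simp only: completion_closure_trace[OF compl])
  qed

  have sub: "subgroup (V\<^sub>0s \<times> \<Gamma>s) P"
    unfolding P_def
  proof (rule subgroup_semidirect_product[OF act'])
    have "subgroup V\<^sub>0s M" "subgroup \<Gamma>s M"
      unfolding V\<^sub>0s \<Gamma>s by (intro M.subgroups_Inter_pair M\<^sub>0 Vs Gs)+
    then show "subgroup V\<^sub>0s (M\<lparr>carrier := Vs\<rparr>)" "subgroup \<Gamma>s (M\<lparr>carrier := Gs\<rparr>)"
      by (auto intro!: M.subgroup_incl Vs Gs simp: V\<^sub>0s \<Gamma>s)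
    show "\<psi> h w \<in> V\<^sub>0s" if "h \<in> \<Gamma>s" "w \<in> V\<^sub>0s" for h w
      using that norm by (auto simp: \<psi>_def conjugation_on_def V\<^sub>0s \<Gamma>s)
  qed

  \<comment> \<open>\<open>V\<^sub>0\<^sup>\<sharp>\<close> and \<open>\<Gamma>\<^sup>\<sharp>\<close> are closed in the compact \<open>M\<^sub>0\<close>, and open in \<open>V\<^sup>\<sharp>\<close> and \<open>G\<^sup>\<sharp>\<close> as traces of the
    open \<open>M\<^sub>0\<close>.\<close>
  have cpt: "compactin T V\<^sub>0s" "compactin T \<Gamma>s"
    unfolding V\<^sub>0s \<Gamma>s Vs_def Gs_def
    by (intro compact_Int_closedin M\<^sub>0 closed)+
  have compact: "compactin (prod_topology (subtopology T Vs) (subtopology T Gs)) (V\<^sub>0s \<times> \<Gamma>s)"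
    using cpt by (auto simp: compactin_Times compactin_subtopology V\<^sub>0s \<Gamma>s)
  have op: "openin (prod_topology (subtopology T Vs) (subtopology T Gs)) (V\<^sub>0s \<times> \<Gamma>s)"
    using M\<^sub>0(3) by (auto simp: openin_prod_Times_iff V\<^sub>0s \<Gamma>s intro: openin_subtopology_Int)

  have \<rho>car: "\<rho> ` X \<subseteq> topspace T" if "X \<subseteq> carrier N" for X
    using that by (auto simp: M.topspace_eq)
  have \<rho>sharp: "\<rho> ` X \<subseteq> sharp X" if "X \<subseteq> carrier N" for X
    unfolding sharp_def by (rule closure_of_subset[OF \<rho>car[OF that]])
  have dense: "subtopology T (sharp X) closure_of (\<rho> ` X) = sharp X" if "X \<subseteq> carrier N" for X
    unfolding sharp_def by (rule closure_of_in_closure_of[OF \<rho>car[OF that]])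
  have \<iota>img: "\<iota> ` (A \<times> B) = \<rho> ` (A \<times> {\<one>\<^bsub>G\<^esub>}) \<times> \<rho> ` ({\<one>\<^bsub>V\<^esub>} \<times> B)" for A B
    by (force simp: \<iota>_def)
  have carP: "carrier P = Vs \<times> Gs" by (simp add: P_def semidirect_product_def)

  have \<iota>: "\<iota> \<in> hom N P"
  proof (rule homI)
    have in_Vs: "\<rho> (v, \<one>\<^bsub>G\<^esub>) \<in> Vs" if "v \<in> carrier V" for v
      using \<rho>sharp[of "carrier V \<times> {\<one>\<^bsub>G\<^esub>}"] that by (auto simp: Vs_def carN)
    have in_Gs: "\<rho> (\<one>\<^bsub>V\<^esub>, g) \<in> Gs" if "g \<in> carrier G" for g
      using \<rho>sharp[of "{\<one>\<^bsub>V\<^esub>} \<times> carrier G"] that by (auto simp: Gs_def carN)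
    show "\<iota> x \<in> carrier P" if "x \<in> carrier N" for x
      using that in_Vs in_Gs by (auto simp: \<iota>_def carP carN)
    show "\<iota> (x \<otimes>\<^bsub>N\<^esub> y) = \<iota> x \<otimes>\<^bsub>P\<^esub> \<iota> y" if xy: "x \<in> carrier N" "y \<in> carrier N" for x y
    proof -
      obtain v g w h where x: "x = (v, g)" "v \<in> carrier V" "g \<in> carrier G"
        and y: "y = (w, h)" "w \<in> carrier V" "h \<in> carrier G"
        using xy by (auto simp: carN)
      have "\<rho> (v \<otimes>\<^bsub>V\<^esub> \<phi> g w, \<one>\<^bsub>G\<^esub>) = \<rho> (v, \<one>\<^bsub>G\<^esub>) \<otimes>\<^bsub>M\<^esub> \<rho> (\<phi> g w, \<one>\<^bsub>G\<^esub>)"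
      proof -
        have "(v, \<one>\<^bsub>G\<^esub>) \<in> carrier N" "(\<phi> g w, \<one>\<^bsub>G\<^esub>) \<in> carrier N"
          using x y by (auto simp: carN \<phi>V)
        moreover have "(v, \<one>\<^bsub>G\<^esub>) \<otimes>\<^bsub>N\<^esub> (\<phi> g w, \<one>\<^bsub>G\<^esub>) = (v \<otimes>\<^bsub>V\<^esub> \<phi> g w, \<one>\<^bsub>G\<^esub>)"
          using x y by (simp add: N_def semidirect_product_def actD(3)[OF G.one_closed] \<phi>V)
        ultimately show ?thesis using \<rho>.hom_mult by metis
      qed
      moreover have "\<rho> (\<one>\<^bsub>V\<^esub>, g \<otimes>\<^bsub>G\<^esub> h) = \<rho> (\<one>\<^bsub>V\<^esub>, g) \<otimes>\<^bsub>M\<^esub> \<rho> (\<one>\<^bsub>V\<^esub>, h)"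
      proof -
        have "(\<one>\<^bsub>V\<^esub>, g) \<in> carrier N" "(\<one>\<^bsub>V\<^esub>, h) \<in> carrier N"
          using x y by (auto simp: carN)
        moreover have "(\<one>\<^bsub>V\<^esub>, g) \<otimes>\<^bsub>N\<^esub> (\<one>\<^bsub>V\<^esub>, h) = (\<one>\<^bsub>V\<^esub>, g \<otimes>\<^bsub>G\<^esub> h)"
          using x by (simp add: N_def semidirect_product_def \<phi>1)
        ultimately show ?thesis using \<rho>.hom_mult by metis
      qed
      \<comment> \<open>Conjugating \<open>\<rho>(w)\<close> by \<open>\<rho>(g)\<close> gives \<open>\<rho>(g(w))\<close>, so \<open>\<iota>\<close> intertwines the two actions.\<close>
      moreover have "\<psi> (\<rho> (\<one>\<^bsub>V\<^esub>, g)) (\<rho> (w, \<one>\<^bsub>G\<^esub>)) = \<rho> (\<phi> g w, \<one>\<^bsub>G\<^esub>)"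
        using x y in_Vs by (simp add: \<psi>_def conjugation_on_def \<rho>conj)
      ultimately show ?thesis
        by (simp add: x(1) y(1) \<iota>_def P_def N_def semidirect_product_def)
    qed
  qed

  have "hecke_completion N (V\<^sub>0 \<times> \<Gamma>) P (prod_topology (subtopology T Vs) (subtopology T Gs))
      (V\<^sub>0s \<times> \<Gamma>s) \<iota>"
    unfolding hecke_completion_def
  proof (intro conjI)
    show "prod_topology (subtopology T Vs) (subtopology T Gs) closure_of (\<iota> ` carrier N) = carrier P"
      unfolding carN \<iota>img carP closure_of_Times
      by (simp add: Vs_def Gs_def dense carN Sigma_mono)
    show "\<iota> ` (V\<^sub>0 \<times> \<Gamma>) \<subseteq> V\<^sub>0s \<times> \<Gamma>s"
      unfolding \<iota>img V\<^sub>0s_def \<Gamma>s_def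
      by (intro Sigma_mono \<rho>sharp) (use V\<^sub>0.subset \<Gamma>.subset in \<open>auto simp: carN\<close>)
    have "subtopology (prod_topology (subtopology T Vs) (subtopology T Gs)) (V\<^sub>0s \<times> \<Gamma>s)
        = prod_topology (subtopology T V\<^sub>0s) (subtopology T \<Gamma>s)"
      by (simp add: subtopology_Times subtopology_subtopology V\<^sub>0s \<Gamma>s Int_ac)
    then show "subtopology (prod_topology (subtopology T Vs) (subtopology T Gs)) (V\<^sub>0s \<times> \<Gamma>s)
        closure_of (\<iota> ` (V\<^sub>0 \<times> \<Gamma>)) = V\<^sub>0s \<times> \<Gamma>s"
      using V\<^sub>0.subset \<Gamma>.subset
      by (simp add: \<iota>img closure_of_Times V\<^sub>0s_def \<Gamma>s_def dense carN Sigma_mono)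
    \<comment> \<open>Each component separately: \<open>\<rho>(v, 1)\<close> lies in \<open>M\<^sub>0\<close> iff \<open>(v, 1)\<close> lies in \<open>V\<^sub>0 \<rtimes> \<Gamma>\<close>, that is,
      iff \<open>v\<close> lies in \<open>V\<^sub>0\<close>, and likewise for \<open>g\<close> and \<open>\<Gamma>\<close>.\<close>
    have mem: "\<iota> (v, g) \<in> V\<^sub>0s \<times> \<Gamma>s \<longleftrightarrow> (v, g) \<in> V\<^sub>0 \<times> \<Gamma>" if "v \<in> carrier V" "g \<in> carrier G" for v g
      using that pre[of "(v, \<one>\<^bsub>G\<^esub>)"] pre[of "(\<one>\<^bsub>V\<^esub>, g)"] hom_in_carrier[OF \<iota>, of "(v, g)"]
      by (auto simp: V\<^sub>0s \<Gamma>s \<iota>_def carN carP)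
    have "{x \<in> carrier N. \<iota> x \<in> V\<^sub>0s \<times> \<Gamma>s} = {x \<in> carrier N. x \<in> V\<^sub>0 \<times> \<Gamma>}"
      by (intro Collect_cong conj_cong refl)
        (use mem in \<open>metis carN mem_Sigma_iff prod.collapse mem_Times_iff\<close>)
    then show "{x \<in> carrier N. \<iota> x \<in> V\<^sub>0s \<times> \<Gamma>s} = V\<^sub>0 \<times> \<Gamma>"
      using V\<^sub>0.subset \<Gamma>.subset by (auto simp: carN)
  qed (use compl lc sub compact op \<iota> in \<open>auto simp: hecke_completion_def\<close>)
  with cact show ?thesis
    unfolding Let_def N_def P_def \<iota>_def Vs_def Gs_def V\<^sub>0s_def \<Gamma>s_def sharp_def by blast
qed

end
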